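(* If $f:X\to Y$ is a coarsely injective coarse map between metric spaces, then $\nu' f:\nu' X\to\nu' Y$ is a closed embedding.
   Context: All metrics take finite values. For a metric space $X$, an entourage is a set $E\subseteq X^2$ with $\sup_{(x,y)\in E}d(x,y)<\infty$; a subset $B\subseteq X$ is bounded if $B^2$ is an entourage; $E[A]$ denotes the set of points of $X$ that are $E$-related to some point of $A$. A map $f:X\to Y$ is coarse if $(f\times f)(E)$ is an entourage for every entourage $E\subseteq X^2$ and $f^{-1}(B)$ is bounded for every bounded $B\subseteq Y$; it is coarsely injective if $(f\times f)^{-1}(F)$ is an entourage in $X$ for every entourage $F\subseteq Y^2$. Subsets $A,B\subseteq X$ are coarsely disjoint, $A\not\curlywedge B$, if $E[A]\cap E[B]$ is bounded for every entourage $E$; otherwise they are close, $A\curlywedge B$. A coarse ultrafilter on $X$ is a system $\mathcal F$ of subsets of $X$ such that (1) $A,B\in\mathcal F$ implies $A\curlywedge B$; (2) if $A,B\subseteq X$ and $A\cup B\in\mathcal F$ then $A\in\mathcal F$ or $B\in\mathcal F$; (3) $X\in\mathcal F$. Two coarse ultrafilters $\mathcal F,\mathcal G$ are asymptotically alike, $\mathcal F\lambda\mathcal G$, if $A\curlywedge B$ for all $A\in\mathcal F$, $B\in\mathcal G$; this is an equivalence relation. The corona $\nu' X$ is the set of coarse ultrafilters on $X$ modulo $\lambda$. For $A\subseteq X$ let $\mathrm{cl}(A)\subseteq\nu' X$ be the set of classes having a representative $\mathcal F$ with $A\in\mathcal F$. For $\pi_1,\pi_2\subseteq\nu' X$ put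 $\pi_1\not\curlywedge\pi_2$ if there are $A,B\subseteq X$ with $A\not\curlywedge B$, $\pi_1\subseteq\mathrm{cl}(A)$, $\pi_2\subseteq\mathrm{cl}(B)$, and $\pi_1\curlywedge\pi_2$ otherwise; this is a separated proximity relation and $\nu' X$ carries the induced topology, in which the closure of $\pi$ is $\{x:\{x\}\curlywedge\pi\}$. A coarse map $f:X\to Y$ induces $\nu' f:\nu' X\to\nu' Y$, $[\mathcal F]\mapsto[f_*\mathcal F]$, where $f_*\mathcal F=\{A\subseteq Y:f^{-1}(A)\in\mathcal F\}$. *)

theory Defs
  imports "HOL-Analysis.Analysis"
begin

definition entourage :: "'a metric \<Rightarrow> ('a \<times> 'a) set \<Rightarrow> bool" where
  "entourage X E \<longleftrightarrow>
     E \<subseteq> mspace X \<times> mspace X \<and> bdd_above ((\<lambda>(x, y). mdist X x y) ` E)"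

definition coarsely_bounded :: "'a metric \<Rightarrow> 'a set \<Rightarrow> bool" where
  "coarsely_bounded X B \<longleftrightarrow> B \<subseteq> mspace X \<and> entourage X (B \<times> B)"

definition thicken :: "('a \<times> 'a) set \<Rightarrow> 'a set \<Rightarrow> 'a set" where
  "thicken E A = {x. \<exists>a\<in>A. (x, a) \<in> E}"

definition coarse_map :: "'a metric \<Rightarrow> 'b metric \<Rightarrow> ('a \<Rightarrow> 'b) \<Rightarrow> bool" where
  "coarse_map X Y f \<longleftrightarrow>
     f \<in> mspace X \<rightarrow> mspace Y \<and>
     (\<forall>E. entourage X E \<longrightarrow> entourage Y (map_prod f f ` E)) \<and>
     (\<forall>B. coarsely_bounded Y B \<longrightarrow> coarsely_bounded X (f -` B \<inter> mspace X))"

definition coarsely_injective :: "'a metric \<Rightarrow> 'b metric \<Rightarrow> ('a \<Rightarrow> 'b) \<Rightarrow> bool" where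
  "coarsely_injective X Y f \<longleftrightarrow>
     (\<forall>F. entourage Y F \<longrightarrow> entourage X (map_prod f f -` F \<inter> mspace X \<times> mspace X))"

definition coarsely_disjoint :: "'a metric \<Rightarrow> 'a set \<Rightarrow> 'a set \<Rightarrow> bool" where
  "coarsely_disjoint X A B \<longleftrightarrow>
     (\<forall>E. entourage X E \<longrightarrow> coarsely_bounded X (thicken E A \<inter> thicken E B))"

abbreviation coarsely_close :: "'a metric \<Rightarrow> 'a set \<Rightarrow> 'a set \<Rightarrow> bool" where
  "coarsely_close X A B \<equiv> \<not> coarsely_disjoint X A B"

text \<open>Coarse ultrafilters are not required to be closed under supersets or intersections.\<close>

definition coarse_ultrafilter :: "'a metric \<Rightarrow> 'a set set \<Rightarrow> bool" where
  "coarse_ultrafilter X \<F> \<longleftrightarrow>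
     \<F> \<subseteq> Pow (mspace X) \<and>
     (\<forall>A\<in>\<F>. \<forall>B\<in>\<F>. coarsely_close X A B) \<and>
     (\<forall>A B. A \<subseteq> mspace X \<longrightarrow> B \<subseteq> mspace X \<longrightarrow> A \<union> B \<in> \<F> \<longrightarrow> A \<in> \<F> \<or> B \<in> \<F>) \<and>
     mspace X \<in> \<F>"

definition asymptotically_alike :: "'a metric \<Rightarrow> ('a set set \<times> 'a set set) set" where
  "asymptotically_alike X =
     {(\<F>, \<G>). coarse_ultrafilter X \<F> \<and> coarse_ultrafilter X \<G> \<and>
        (\<forall>A\<in>\<F>. \<forall>B\<in>\<G>. coarsely_close X A B)}"

definition corona :: "'a metric \<Rightarrow> 'a set set set set" where
  "corona X = Collect (coarse_ultrafilter X) // asymptotically_alike X"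

definition corona_cl :: "'a metric \<Rightarrow> 'a set \<Rightarrow> 'a set set set set" where
  "corona_cl X A = {x \<in> corona X. \<exists>\<F>\<in>x. A \<in> \<F>}"

definition corona_apart ::
    "'a metric \<Rightarrow> 'a set set set set \<Rightarrow> 'a set set set set \<Rightarrow> bool" where
  "corona_apart X P Q \<longleftrightarrow>
     (\<exists>A B. A \<subseteq> mspace X \<and> B \<subseteq> mspace X \<and> coarsely_disjoint X A B \<and>
        P \<subseteq> corona_cl X A \<and> Q \<subseteq> corona_cl X B)"

abbreviation corona_close ::
    "'a metric \<Rightarrow> 'a set set set set \<Rightarrow> 'a set set set set \<Rightarrow> bool" where
  "corona_close X P Q \<equiv> \<not> corona_apart X P Q"

text \<open>The topology induced by the proximity: \<open>U\<close> is open iff no point of \<open>U\<close> is close to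
  the complement of \<open>U\<close>. That this is a topology, and that its closure operator
  is the one given by the proximity, is proved below in \<open>istopology_corona\<close> and
  \<open>closure_of_corona_topology\<close>.\<close>

definition corona_topology :: "'a metric \<Rightarrow> 'a set set set topology" where
  "corona_topology X =
     topology (\<lambda>U. U \<subseteq> corona X \<and> (\<forall>x\<in>U. corona_apart X {x} (corona X - U)))"

definition pushforward :: "'a metric \<Rightarrow> 'b metric \<Rightarrow> ('a \<Rightarrow> 'b) \<Rightarrow> 'a set set \<Rightarrow> 'b set set" where
  "pushforward X Y f \<F> = {A. A \<subseteq> mspace Y \<and> f -` A \<inter> mspace X \<in> \<F>}"

text \<open>The image of a class is the union of the classes of the pushforwards of its members;
  by \<open>corona_map_class\<close> below these all coincide.\<close>

definition corona_map ::
    "'a metric \<Rightarrow> 'b metric \<Rightarrow> ('a \<Rightarrow> 'b) \<Rightarrow> 'a set set set \<Rightarrow> 'b set set set" where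
  "corona_map X Y f x = asymptotically_alike Y `` (pushforward X Y f ` x)"


lemma entourage_iff:
  "entourage X E \<longleftrightarrow>
     E \<subseteq> mspace X \<times> mspace X \<and> (\<exists>R. \<forall>(x, y)\<in>E. mdist X x y \<le> R)"
  by (auto simp: entourage_def bdd_above_def)

lemma coarsely_bounded_iff:
  "coarsely_bounded X B \<longleftrightarrow>
     B \<subseteq> mspace X \<and> (\<exists>R. \<forall>x\<in>B. \<forall>y\<in>B. mdist X x y \<le> R)"
  by (fastforce simp: coarsely_bounded_def entourage_iff)

lemma coarsely_bounded_subset:
  "coarsely_bounded X B \<Longrightarrow> A \<subseteq> B \<Longrightarrow> coarsely_bounded X A"
  unfolding coarsely_bounded_iff by (meson subset_eq)

lemma coarsely_bounded_Un:
  assumes "coarsely_bounded X A" "coarsely_bounded X B"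
  shows "coarsely_bounded X (A \<union> B)"
proof (cases "A = {} \<or> B = {}")
  case True
  then show ?thesis using assms by auto
next
  case False
  then obtain a b where a: "a \<in> A" and b: "b \<in> B" by auto
  obtain R where R: "A \<subseteq> mspace X" "\<And>x y. x \<in> A \<Longrightarrow> y \<in> A \<Longrightarrow> mdist X x y \<le> R"
    using assms(1) by (auto simp: coarsely_bounded_iff)
  obtain S where S: "B \<subseteq> mspace X" "\<And>x y. x \<in> B \<Longrightarrow> y \<in> B \<Longrightarrow> mdist X x y \<le> S"
    using assms(2) by (auto simp: coarsely_bounded_iff)
  have mixed: "mdist X x y \<le> R + mdist X a b + S" if "x \<in> A" "y \<in> B" for x y
  proof -
    have "mdist X x y \<le> mdist X x a + mdist X a y"
      using that a R(1) S(1) by (intro mdist_triangle) auto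
    moreover have "mdist X a y \<le> mdist X a b + mdist X b y"
      using that a b R(1) S(1) by (intro mdist_triangle) auto
    ultimately show ?thesis using R(2)[OF that(1) a] S(2)[OF b that(2)] by linarith
  qed
  have "0 \<le> R" "0 \<le> S"
    using order_trans[OF mdist_nonneg R(2)[OF a a]] order_trans[OF mdist_nonneg S(2)[OF b b]] .
  then have "mdist X x y \<le> R + mdist X a b + S" if "x \<in> A \<union> B" "y \<in> A \<union> B" for x y
    using that mixed[of x y] mixed[of y x] R(2)[of x y] S(2)[of x y]
      mdist_nonneg[of X a b] mdist_commute[of X x y] by (smt (verit) UnE)
  then show ?thesis using R(1) S(1) unfolding coarsely_bounded_iff by blast
qed

definition nbhd :: "'a metric \<Rightarrow> real \<Rightarrow> 'a set \<Rightarrow> 'a set" where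
  "nbhd X R A = {x \<in> mspace X. \<exists>a\<in>A. a \<in> mspace X \<and> mdist X x a \<le> R}"

lemma coarsely_disjoint_iff:
  "coarsely_disjoint X A B \<longleftrightarrow> (\<forall>R. coarsely_bounded X (nbhd X R A \<inter> nbhd X R B))"
proof
  assume L: "coarsely_disjoint X A B"
  show "\<forall>R. coarsely_bounded X (nbhd X R A \<inter> nbhd X R B)"
  proof
    fix R
    define E where "E = {(x, y). x \<in> mspace X \<and> y \<in> mspace X \<and> mdist X x y \<le> R}"
    have "entourage X E" by (auto simp: entourage_iff E_def)
    moreover have "thicken E C = nbhd X R C" for C
      by (auto simp: thicken_def nbhd_def E_def)
    ultimately show "coarsely_bounded X (nbhd X R A \<inter> nbhd X R B)"
      using L by (auto simp: coarsely_disjoint_def)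
  qed
next
  assume R: "\<forall>R. coarsely_bounded X (nbhd X R A \<inter> nbhd X R B)"
  show "coarsely_disjoint X A B"
    unfolding coarsely_disjoint_def
  proof (intro allI impI)
    fix E assume "entourage X E"
    then obtain r where E: "E \<subseteq> mspace X \<times> mspace X" "\<forall>(x, y)\<in>E. mdist X x y \<le> r"
      by (auto simp: entourage_iff)
    then have "thicken E C \<subseteq> nbhd X r C" for C
      by (fastforce simp: thicken_def nbhd_def)
    then show "coarsely_bounded X (thicken E A \<inter> thicken E B)"
      using R coarsely_bounded_subset by (meson Int_mono)
  qed
qed

lemma coarsely_disjoint_commute: "coarsely_disjoint X A B \<longleftrightarrow> coarsely_disjoint X B A"
  by (simp add: coarsely_disjoint_def Int_commute)

lemma coarsely_disjoint_empty: "coarsely_disjoint X A {}"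
  by (simp add: coarsely_disjoint_def thicken_def coarsely_bounded_iff)

lemma coarsely_disjoint_mono:
  assumes "coarsely_disjoint X A B" "A' \<subseteq> A" "B' \<subseteq> B"
  shows "coarsely_disjoint X A' B'"
proof -
  have "nbhd X R A' \<inter> nbhd X R B' \<subseteq> nbhd X R A \<inter> nbhd X R B" for R
    using assms(2,3) by (auto simp: nbhd_def)
  then show ?thesis
    using assms(1) coarsely_bounded_subset unfolding coarsely_disjoint_iff by blast
qed

lemma coarsely_disjoint_Un:
  assumes "coarsely_disjoint X A B" "coarsely_disjoint X A C"
  shows "coarsely_disjoint X A (B \<union> C)"
proof -
  have "nbhd X R A \<inter> nbhd X R (B \<union> C)
      = (nbhd X R A \<inter> nbhd X R B) \<union> (nbhd X R A \<inter> nbhd X R C)" for R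
    by (auto simp: nbhd_def)
  then show ?thesis
    using assms coarsely_bounded_Un unfolding coarsely_disjoint_iff by metis
qed

lemma coarsely_disjoint_separate:
  assumes disj: "coarsely_disjoint X A B" and A: "A \<subseteq> mspace X" and B: "B \<subseteq> mspace X"
  obtains C D where "C \<union> D = mspace X" "coarsely_disjoint X C A" "coarsely_disjoint X D B"
proof -
  define D where "D = {x \<in> mspace X. \<forall>b\<in>B. \<exists>a\<in>A. mdist X x a \<le> mdist X x b}"
  define C where "C = mspace X - D"
  have tri: "nbhd X R {x} \<inter> nbhd X R S \<subseteq> nbhd X (3 * R) T"
    if "x \<in> mspace X" "S \<subseteq> mspace X" "T \<subseteq> mspace X"
      and nearer: "\<And>s. s \<in> S \<Longrightarrow> \<exists>t\<in>T. mdist X x t \<le> mdist X x s" for x R S T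
  proof
    fix p assume "p \<in> nbhd X R {x} \<inter> nbhd X R S"
    then obtain s where s: "p \<in> mspace X" "mdist X p x \<le> R" "s \<in> S" "mdist X p s \<le> R"
      by (auto simp: nbhd_def)
    obtain t where t: "t \<in> T" "mdist X x t \<le> mdist X x s" using nearer s(3) by blast
    have "mdist X x s \<le> mdist X x p + mdist X p s"
      using that s by (intro mdist_triangle) auto
    moreover have "mdist X p t \<le> mdist X p x + mdist X x t"
      using that s t by (intro mdist_triangle) auto
    ultimately have "mdist X p t \<le> 3 * R"
      using s t mdist_commute[of X x p] by linarith
    then show "p \<in> nbhd X (3 * R) T" using s t that by (auto simp: nbhd_def)
  qed
  have widen: "nbhd X R S \<subseteq> nbhd X (3 * R) S" for R S
  proof
    fix p assume "p \<in> nbhd X R S"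
    then obtain s where s: "p \<in> mspace X" "s \<in> S" "s \<in> mspace X" "mdist X p s \<le> R"
      by (auto simp: nbhd_def)
    then have "mdist X p s \<le> 3 * R" using mdist_nonneg[of X p s] by linarith
    then show "p \<in> nbhd X (3 * R) S" using s by (auto simp: nbhd_def)
  qed
  have union: "nbhd X R S = (\<Union>x\<in>S. nbhd X R {x})" for R S
    by (auto simp: nbhd_def)
  have bounded: "coarsely_bounded X (nbhd X (3 * R) A \<inter> nbhd X (3 * R) B)" for R
    using disj by (simp add: coarsely_disjoint_iff)
  have sub1: "nbhd X R C \<inter> nbhd X R A \<subseteq> nbhd X (3 * R) A \<inter> nbhd X (3 * R) B" for R
  proof -
    have "nbhd X R {x} \<inter> nbhd X R A \<subseteq> nbhd X (3 * R) B" if x: "x \<in> C" for x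
    proof (rule tri)
      show "x \<in> mspace X" using x by (simp add: C_def)
      obtain b where b: "b \<in> B" "\<forall>a\<in>A. \<not> mdist X x a \<le> mdist X x b"
        using x by (auto simp: C_def D_def)
      then show "\<exists>t\<in>B. mdist X x t \<le> mdist X x s" if "s \<in> A" for s
        using that by (meson linear)
    qed (use A B in auto)
    then have "nbhd X R C \<inter> nbhd X R A \<subseteq> nbhd X (3 * R) B"
      unfolding union[of R C] by blast
    then show ?thesis using widen[of R A] by blast
  qed
  have 1: "coarsely_disjoint X C A"
    using coarsely_bounded_subset[OF bounded sub1] by (simp add: coarsely_disjoint_iff)
  have sub2: "nbhd X R D \<inter> nbhd X R B \<subseteq> nbhd X (3 * R) A \<inter> nbhd X (3 * R) B" for R
  proof -
    have "nbhd X R {x} \<inter> nbhd X R B \<subseteq> nbhd X (3 * R) A" if "x \<in> D" for x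
      by (rule tri) (use that A B in \<open>auto simp: D_def\<close>)
    then have "nbhd X R D \<inter> nbhd X R B \<subseteq> nbhd X (3 * R) A"
      unfolding union[of R D] by blast
    then show ?thesis using widen[of R B] by blast
  qed
  have 2: "coarsely_disjoint X D B"
    using coarsely_bounded_subset[OF bounded sub2] by (simp add: coarsely_disjoint_iff)
  show thesis
    by (rule that[OF _ 1 2]) (auto simp: C_def D_def)
qed

lemma coarse_ultrafilter_Un:
  assumes "coarse_ultrafilter X \<F>" "A \<union> B \<in> \<F>"
  shows "A \<in> \<F> \<or> B \<in> \<F>"
  using assms unfolding coarse_ultrafilter_def by (meson Pow_iff Un_subset_iff subsetD)

lemma coarse_ultrafilter_cover:
  assumes "coarse_ultrafilter X \<F>" "C \<union> D = mspace X"
  shows "C \<in> \<F> \<or> D \<in> \<F>"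
  using assms coarse_ultrafilter_Un unfolding coarse_ultrafilter_def by metis

lemma equiv_asymptotically_alike:
  "equiv (Collect (coarse_ultrafilter X)) (asymptotically_alike X)"
proof (rule equivI)
  show "asymptotically_alike X \<subseteq> Collect (coarse_ultrafilter X) \<times> Collect (coarse_ultrafilter X)"
    by (auto simp: asymptotically_alike_def)
  show "refl_on (Collect (coarse_ultrafilter X)) (asymptotically_alike X)"
    by (auto simp: refl_on_def asymptotically_alike_def coarse_ultrafilter_def)
  show "sym (asymptotically_alike X)"
    unfolding sym_def asymptotically_alike_def using coarsely_disjoint_commute by fast
  show "trans (asymptotically_alike X)"
  proof (rule transI)
    fix \<F> \<G> \<H>
    assume FG: "(\<F>, \<G>) \<in> asymptotically_alike X" and GH: "(\<G>, \<H>) \<in> asymptotically_alike X"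
    have "coarsely_close X A B" if "A \<in> \<F>" "B \<in> \<H>" for A B
    proof
      assume "coarsely_disjoint X A B"
      moreover have "A \<subseteq> mspace X" "B \<subseteq> mspace X"
        using FG GH that by (auto simp: asymptotically_alike_def coarse_ultrafilter_def)
      ultimately obtain C D where
        "C \<union> D = mspace X" "coarsely_disjoint X C A" "coarsely_disjoint X D B"
        by (rule coarsely_disjoint_separate)
      moreover have "C \<in> \<G> \<or> D \<in> \<G>"
        using FG calculation(1) coarse_ultrafilter_cover unfolding asymptotically_alike_def by blast
      ultimately show False
        using FG GH that coarsely_disjoint_commute unfolding asymptotically_alike_def by blast
    qed
    then show "(\<F>, \<H>) \<in> asymptotically_alike X"
      using FG GH by (auto simp: asymptotically_alike_def)
  qed
qed

lemma corona_members:
  assumes "x \<in> corona X" "\<F> \<in> x"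
  shows "coarse_ultrafilter X \<F>"
proof -
  have "x \<subseteq> Collect (coarse_ultrafilter X)"
    using assms(1) equiv_asymptotically_alike in_quotient_imp_subset unfolding corona_def by metis
  then show ?thesis using assms(2) by blast
qed

lemma corona_close_members:
  assumes "x \<in> corona X" "\<F> \<in> x" "\<G> \<in> x" "A \<in> \<F>" "B \<in> \<G>"
  shows "coarsely_close X A B"
proof -
  have "(\<F>, \<G>) \<in> asymptotically_alike X"
    using assms equiv_asymptotically_alike unfolding corona_def
    by (metis (no_types, lifting) in_quotient_imp_in_rel insert_subset empty_subsetI)
  then show ?thesis using assms by (auto simp: asymptotically_alike_def)
qed

lemma corona_nonempty: "x \<in> corona X \<Longrightarrow> x \<noteq> {}"
  using equiv_asymptotically_alike in_quotient_imp_non_empty unfolding corona_def by metis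

lemma corona_cl_members:
  assumes "x \<in> corona_cl X A" "A \<subseteq> mspace X" "C \<union> D = mspace X" "coarsely_disjoint X C A" "\<F> \<in> x"
  shows "C \<notin> \<F>" "D \<in> \<F>"
proof -
  from assms obtain \<G> where x: "x \<in> corona X" and G: "\<G> \<in> x" "A \<in> \<G>"
    by (auto simp: corona_cl_def)
  show C: "C \<notin> \<F>" using corona_close_members[OF x assms(5) G(1) _ G(2)] assms(4) by blast
  show "D \<in> \<F>"
    using C coarse_ultrafilter_cover[OF corona_members[OF x assms(5)] assms(3)] by blast
qed

lemma corona_apart_empty: "P \<subseteq> corona X \<Longrightarrow> corona_apart X P {}"
proof -
  assume P: "P \<subseteq> corona X"
  have "P \<subseteq> corona_cl X (mspace X)"
  proof
    fix x assume x: "x \<in> P"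
    then obtain \<F> where "\<F> \<in> x" using P corona_nonempty by blast
    then show "x \<in> corona_cl X (mspace X)"
      using P x corona_members unfolding corona_cl_def coarse_ultrafilter_def by blast
  qed
  then show ?thesis
    unfolding corona_apart_def using coarsely_disjoint_empty by blast
qed

lemma corona_apart_mono: "corona_apart X P Q \<Longrightarrow> P' \<subseteq> P \<Longrightarrow> Q' \<subseteq> Q \<Longrightarrow> corona_apart X P' Q'"
  unfolding corona_apart_def by (meson order_trans)

lemma corona_cl_mono:
  assumes "S \<subseteq> T" "T \<subseteq> mspace X"
  shows "corona_cl X S \<subseteq> corona_cl X T"
proof
  fix x assume x0: "x \<in> corona_cl X S"
  from x0 obtain \<F> where x: "x \<in> corona X" and F: "\<F> \<in> x" "S \<in> \<F>"
    by (auto simp: corona_cl_def)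
  have ult: "coarse_ultrafilter X \<F>" using corona_members[OF x F(1)] .
  define \<G> where "\<G> = {A. A \<subseteq> mspace X \<and> (\<forall>B\<in>\<F>. coarsely_close X A B)}"
  have sub: "\<F> \<subseteq> \<G>" using ult by (auto simp: \<G>_def coarse_ultrafilter_def)
  have sep: "\<exists>C D. C \<union> D = mspace X \<and> coarsely_disjoint X C A \<and> D \<notin> \<F>"
    if A: "A \<subseteq> mspace X" and B: "B \<in> \<F>" and AB: "coarsely_disjoint X B A" for A B
  proof -
    have "B \<subseteq> mspace X" using ult B by (auto simp: coarse_ultrafilter_def)
    then obtain C D where
      "C \<union> D = mspace X" "coarsely_disjoint X C B" "coarsely_disjoint X D A"
      using coarsely_disjoint_separate[OF AB _ A] by metis
    then show ?thesis using ult B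
      by (metis Un_commute coarse_ultrafilter_def)
  qed
  have "coarse_ultrafilter X \<G>"
    unfolding coarse_ultrafilter_def
  proof (intro conjI ballI allI impI)
    show "\<G> \<subseteq> Pow (mspace X)" by (auto simp: \<G>_def)
    show "mspace X \<in> \<G>" using sub ult by (auto simp: coarse_ultrafilter_def)
    fix A B assume A: "A \<in> \<G>" and B: "B \<in> \<G>"
    show "coarsely_close X A B"
    proof
      assume "coarsely_disjoint X A B"
      moreover have "A \<subseteq> mspace X" "B \<subseteq> mspace X" using A B by (auto simp: \<G>_def)
      ultimately obtain C D where
        "C \<union> D = mspace X" "coarsely_disjoint X C A" "coarsely_disjoint X D B"
        by (rule coarsely_disjoint_separate)
      then show False
        using coarse_ultrafilter_cover[OF ult, of C D] A B
        unfolding \<G>_def by (metis (mono_tags, lifting) coarsely_disjoint_commute mem_Collect_eq)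
    qed
  next
    fix A B assume A: "A \<subseteq> mspace X" and B: "B \<subseteq> mspace X" and AB: "A \<union> B \<in> \<G>"
    show "A \<in> \<G> \<or> B \<in> \<G>"
    proof (rule ccontr)
      assume "\<not> ?thesis"
      then obtain A' B' where "A' \<in> \<F>" "coarsely_disjoint X A' A" "B' \<in> \<F>" "coarsely_disjoint X B' B"
        using A B coarsely_disjoint_commute unfolding \<G>_def by blast
      then obtain C D C' D' where
        1: "C \<union> D = mspace X" "coarsely_disjoint X C A" "D \<notin> \<F>" and
        2: "C' \<union> D' = mspace X" "coarsely_disjoint X C' B" "D' \<notin> \<F>"
        using sep A B by metis
      have "(C \<inter> C') \<union> (D \<union> D') = mspace X" using 1(1) 2(1) by blast
      then have "C \<inter> C' \<in> \<F>"
        using coarse_ultrafilter_cover[OF ult] coarse_ultrafilter_Un[OF ult] 1(3) 2(3) by blast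
      moreover have "coarsely_disjoint X (C \<inter> C') (A \<union> B)"
        by (intro coarsely_disjoint_Un coarsely_disjoint_mono[OF 1(2)] coarsely_disjoint_mono[OF 2(2)]) auto
      ultimately show False using AB coarsely_disjoint_commute unfolding \<G>_def by blast
    qed
  qed
  then have "(\<F>, \<G>) \<in> asymptotically_alike X"
    using ult coarsely_disjoint_commute unfolding asymptotically_alike_def \<G>_def by blast
  then have "\<G> \<in> x"
    using x F(1) equiv_asymptotically_alike in_quotient_imp_closed
    unfolding corona_def by metis
  moreover have "T \<in> \<G>"
  proof -
    have "coarsely_close X T B" if "B \<in> \<F>" for B
      using ult F(2) that coarsely_disjoint_mono[OF _ assms(1) order_refl]
      unfolding coarse_ultrafilter_def by blast
    then show ?thesis using assms by (simp add: \<G>_def)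
  qed
  ultimately show "x \<in> corona_cl X T" using x by (auto simp: corona_cl_def)
qed

lemma corona_apart_point_Un:
  assumes "corona_apart X {x} P" "corona_apart X {x} Q"
  shows "corona_apart X {x} (P \<union> Q)"
proof -
  obtain A B where 1: "A \<subseteq> mspace X" "B \<subseteq> mspace X" "coarsely_disjoint X A B"
      "x \<in> corona_cl X A" "P \<subseteq> corona_cl X B"
    using assms(1) by (auto simp: corona_apart_def)
  obtain A' B' where 2: "A' \<subseteq> mspace X" "B' \<subseteq> mspace X" "coarsely_disjoint X A' B'"
      "x \<in> corona_cl X A'" "Q \<subseteq> corona_cl X B'"
    using assms(2) by (auto simp: corona_apart_def)
  obtain C D where CD: "C \<union> D = mspace X" "coarsely_disjoint X C A" "coarsely_disjoint X D B"
    using coarsely_disjoint_separate 1(1-3) by metis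
  obtain C' D' where CD': "C' \<union> D' = mspace X" "coarsely_disjoint X C' A'" "coarsely_disjoint X D' B'"
    using coarsely_disjoint_separate 2(1-3) by metis
  have x: "x \<in> corona X" using 1(4) by (simp add: corona_cl_def)
  then obtain \<F> where F: "\<F> \<in> x" using corona_nonempty by blast
  have ult: "coarse_ultrafilter X \<F>" using corona_members[OF x F] .
  have "(D \<inter> D') \<union> (C \<union> C') = mspace X" using CD(1) CD'(1) by blast
  then have "D \<inter> D' \<in> \<F>"
    using coarse_ultrafilter_cover[OF ult] coarse_ultrafilter_Un[OF ult]
      corona_cl_members(1)[OF 1(4,1) CD(1,2) F] corona_cl_members(1)[OF 2(4,1) CD'(1,2) F] by blast
  then have "{x} \<subseteq> corona_cl X (D \<inter> D')" using x F by (auto simp: corona_cl_def)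
  moreover have "coarsely_disjoint X (D \<inter> D') (B \<union> B')"
    by (intro coarsely_disjoint_Un coarsely_disjoint_mono[OF CD(3)] coarsely_disjoint_mono[OF CD'(3)]) auto
  moreover have "P \<union> Q \<subseteq> corona_cl X (B \<union> B')"
    using 1(2,5) 2(2,5) corona_cl_mono[of _ "B \<union> B'"] by blast
  moreover have "D \<inter> D' \<subseteq> mspace X" "B \<union> B' \<subseteq> mspace X"
    using CD(1) 1(2) 2(2) by blast+
  ultimately show ?thesis
    unfolding corona_apart_def by (intro exI conjI)
qed

lemma istopology_corona:
  "istopology (\<lambda>U. U \<subseteq> corona X \<and> (\<forall>x\<in>U. corona_apart X {x} (corona X - U)))"
  unfolding istopology_def
proof (intro conjI allI impI ballI; (elim conjE)?)
  fix S T x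
  assume S: "S \<subseteq> corona X" "\<forall>x\<in>S. corona_apart X {x} (corona X - S)"
    and T: "T \<subseteq> corona X" "\<forall>x\<in>T. corona_apart X {x} (corona X - T)"
    and x: "x \<in> S \<inter> T"
  have "corona X - S \<inter> T = (corona X - S) \<union> (corona X - T)" by blast
  then show "corona_apart X {x} (corona X - S \<inter> T)"
    using corona_apart_point_Un[of X x "corona X - S" "corona X - T"] S(2) T(2) x by simp
next
  fix \<U> x
  assume U: "\<forall>U\<in>\<U>. U \<subseteq> corona X \<and> (\<forall>x\<in>U. corona_apart X {x} (corona X - U))"
    and x: "x \<in> \<Union>\<U>"
  then obtain U where V: "U \<in> \<U>" "x \<in> U" by blast
  then have "corona_apart X {x} (corona X - U)" using U by blast
  then show "corona_apart X {x} (corona X - \<Union>\<U>)"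
    by (rule corona_apart_mono) (use V in auto)
qed auto

lemma openin_corona_topology:
  "openin (corona_topology X) U \<longleftrightarrow>
     U \<subseteq> corona X \<and> (\<forall>x\<in>U. corona_apart X {x} (corona X - U))"
  unfolding corona_topology_def by (simp add: istopology_corona)

lemma topspace_corona_topology [simp]: "topspace (corona_topology X) = corona X"
proof
  show "topspace (corona_topology X) \<subseteq> corona X"
    by (auto simp: topspace_def openin_corona_topology)
  have "openin (corona_topology X) (corona X)"
    by (auto simp: openin_corona_topology intro!: corona_apart_empty)
  then show "corona X \<subseteq> topspace (corona_topology X)" by (rule openin_subset)
qed

lemma corona_apart_point_not_in:
  assumes "corona_apart X {x} P"
  shows "x \<notin> P"
proof
  assume "x \<in> P"
  then obtain A B where "coarsely_disjoint X A B" "x \<in> corona_cl X A" "x \<in> corona_cl X B"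
    using assms by (auto simp: corona_apart_def)
  then show False using corona_close_members unfolding corona_cl_def by blast
qed

lemma closure_of_corona_topology:
  assumes P: "P \<subseteq> corona X"
  shows "corona_topology X closure_of P = {x \<in> corona X. corona_close X {x} P}"
proof (rule closure_of_unique)
  let ?K = "{x \<in> corona X. corona_close X {x} P}"
  show "P \<subseteq> ?K" using P corona_apart_point_not_in by blast
  show "closedin (corona_topology X) ?K"
    unfolding closedin_def openin_corona_topology
  proof (intro conjI ballI)
    fix x assume "x \<in> topspace (corona_topology X) - ?K"
    then have "corona_apart X {x} P" by simp
    then obtain A B where AB: "A \<subseteq> mspace X" "B \<subseteq> mspace X" "coarsely_disjoint X A B"
        "x \<in> corona_cl X A" "P \<subseteq> corona_cl X B"
      by (auto simp: corona_apart_def)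
    obtain C D where CD: "C \<union> D = mspace X" "coarsely_disjoint X C A" "coarsely_disjoint X D B"
      using coarsely_disjoint_separate[OF AB(3,1,2)] by metis
    then have sub: "C \<subseteq> mspace X" "D \<subseteq> mspace X" by blast+
    have "y \<in> corona_cl X C" if y: "y \<in> ?K" for y
    proof -
      obtain \<F> where F: "\<F> \<in> y" using y corona_nonempty by blast
      have "y \<notin> corona_cl X D"
        using y AB(2,5) CD(3) sub(2) unfolding corona_apart_def by blast
      then have "C \<in> \<F>"
        using F y coarse_ultrafilter_cover[OF corona_members[of y X \<F>] CD(1)]
        by (auto simp: corona_cl_def)
      then show ?thesis using F y by (auto simp: corona_cl_def)
    qed
    then have "corona_apart X {x} ?K"
      unfolding corona_apart_def using AB(1,4) CD(2) sub(1) coarsely_disjoint_commute[of X C A] by blast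
    then show "corona_apart X {x} (corona X - (topspace (corona_topology X) - ?K))"
      by (rule corona_apart_mono) auto
  qed auto
  fix T assume T: "P \<subseteq> T" "closedin (corona_topology X) T"
  show "?K \<subseteq> T"
  proof (rule ccontr)
    assume "\<not> ?K \<subseteq> T"
    then obtain x where x: "x \<in> corona X" "corona_close X {x} P" "x \<notin> T" by blast
    have "corona X - (corona X - T) = T"
      using T(2) closedin_subset by fastforce
    then have "corona_apart X {x} T"
      using T(2) x(1,3) by (auto simp: closedin_def openin_corona_topology)
    then show False using x(2) T(1) corona_apart_mono by blast
  qed
qed

lemma coarse_map_entourage:
  "coarse_map X Y f \<Longrightarrow> entourage X E \<Longrightarrow> entourage Y (map_prod f f ` E)"
  by (simp add: coarse_map_def)

lemma coarse_map_bounded_vimage: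
  "coarse_map X Y f \<Longrightarrow> coarsely_bounded Y B \<Longrightarrow> coarsely_bounded X (f -` B \<inter> mspace X)"
  by (simp add: coarse_map_def)

lemma coarsely_disjoint_vimage:
  assumes f: "coarse_map X Y f" and disj: "coarsely_disjoint Y A B"
  shows "coarsely_disjoint X (f -` A \<inter> mspace X) (f -` B \<inter> mspace X)"
  unfolding coarsely_disjoint_def
proof (intro allI impI)
  fix E assume E: "entourage X E"
  let ?F = "map_prod f f ` E"
  have "entourage Y ?F" using f E by (rule coarse_map_entourage)
  then have "coarsely_bounded Y (thicken ?F A \<inter> thicken ?F B)"
    using disj by (simp add: coarsely_disjoint_def)
  then have "coarsely_bounded X (f -` (thicken ?F A \<inter> thicken ?F B) \<inter> mspace X)"
    by (rule coarse_map_bounded_vimage[OF f])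
  moreover have "thicken E (f -` A \<inter> mspace X) \<inter> thicken E (f -` B \<inter> mspace X)
      \<subseteq> f -` (thicken ?F A \<inter> thicken ?F B) \<inter> mspace X"
  proof -
    have "E \<subseteq> mspace X \<times> mspace X" using E by (simp add: entourage_def)
    moreover have "(f x, f y) \<in> ?F" if "(x, y) \<in> E" for x y
      using that by (force simp: map_prod_def)
    ultimately show ?thesis unfolding thicken_def by blast
  qed
  ultimately show "coarsely_bounded X (thicken E (f -` A \<inter> mspace X) \<inter> thicken E (f -` B \<inter> mspace X))"
    by (rule coarsely_bounded_subset)
qed

lemma coarse_ultrafilter_pushforward:
  assumes f: "coarse_map X Y f" and F: "coarse_ultrafilter X \<F>"
  shows "coarse_ultrafilter Y (pushforward X Y f \<F>)"
  unfolding coarse_ultrafilter_def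
proof (intro conjI ballI allI impI)
  show "pushforward X Y f \<F> \<subseteq> Pow (mspace Y)" by (auto simp: pushforward_def)
  have "f -` mspace Y \<inter> mspace X = mspace X" using f by (auto simp: coarse_map_def)
  then show "mspace Y \<in> pushforward X Y f \<F>"
    using F by (auto simp: pushforward_def coarse_ultrafilter_def)
next
  fix A B assume "A \<in> pushforward X Y f \<F>" "B \<in> pushforward X Y f \<F>"
  then have "f -` A \<inter> mspace X \<in> \<F>" "f -` B \<inter> mspace X \<in> \<F>"
    by (simp_all add: pushforward_def)
  then have "coarsely_close X (f -` A \<inter> mspace X) (f -` B \<inter> mspace X)"
    using F by (simp add: coarse_ultrafilter_def)
  then show "coarsely_close Y A B"
    using coarsely_disjoint_vimage[OF f, of A B] by metis
next
  fix A B assume AB: "A \<subseteq> mspace Y" "B \<subseteq> mspace Y" "A \<union> B \<in> pushforward X Y f \<F>"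
  then have "(f -` A \<inter> mspace X) \<union> (f -` B \<inter> mspace X) \<in> \<F>"
    by (simp add: pushforward_def vimage_Un Int_Un_distrib2)
  then show "A \<in> pushforward X Y f \<F> \<or> B \<in> pushforward X Y f \<F>"
    using AB(1,2) coarse_ultrafilter_Un[OF F] by (simp add: pushforward_def)
qed

lemma corona_map_class:
  assumes f: "coarse_map X Y f" and F: "coarse_ultrafilter X \<F>"
  shows "corona_map X Y f (asymptotically_alike X `` {\<F>})
       = asymptotically_alike Y `` {pushforward X Y f \<F>}"
proof -
  have same: "asymptotically_alike Y `` {pushforward X Y f \<G>} = asymptotically_alike Y `` {pushforward X Y f \<F>}"
    if "(\<F>, \<G>) \<in> asymptotically_alike X" for \<G>
  proof -
    have G: "coarse_ultrafilter X \<G>" and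
        close: "\<And>A B. A \<in> \<F> \<Longrightarrow> B \<in> \<G> \<Longrightarrow> coarsely_close X A B"
      using that by (auto simp: asymptotically_alike_def)
    have "coarsely_close Y A B" if "A \<in> pushforward X Y f \<F>" "B \<in> pushforward X Y f \<G>" for A B
    proof -
      have "f -` A \<inter> mspace X \<in> \<F>" "f -` B \<inter> mspace X \<in> \<G>"
        using that by (simp_all add: pushforward_def)
      then show ?thesis
        using close coarsely_disjoint_vimage[OF f, of A B] by metis
    qed
    then have "(pushforward X Y f \<F>, pushforward X Y f \<G>) \<in> asymptotically_alike Y"
      using coarse_ultrafilter_pushforward[OF f] F G by (auto simp: asymptotically_alike_def)
    then show ?thesis
      using equiv_class_eq[OF equiv_asymptotically_alike] by metis
  qed
  let ?C = "asymptotically_alike X `` {\<F>}"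
  have "\<F> \<in> ?C"
    using F by (auto simp: asymptotically_alike_def coarse_ultrafilter_def)
  then have "(\<Union>\<G>\<in>?C. asymptotically_alike Y `` {pushforward X Y f \<G>})
      = asymptotically_alike Y `` {pushforward X Y f \<F>}"
    by (rule UN_constant_eq) (intro ballI same, simp)
  moreover have "corona_map X Y f ?C = (\<Union>\<G>\<in>?C. asymptotically_alike Y `` {pushforward X Y f \<G>})"
    unfolding corona_map_def by (subst Image_eq_UN) simp
  ultimately show ?thesis by simp
qed

end

theory Submission
  imports Defs
begin

text \<open>Under a coarse map \<open>f\<close>, preimages of coarsely disjoint sets are coarsely disjoint; if \<open>f\<close> is
  coarsely injective, so are images. Hence \<open>\<nu>' f\<close> preserves and reflects the proximity, which
  yields continuity and injectivity. Every point in the closure of an image \<open>\<nu>' f(S)\<close> lies in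
  \<open>cl(f(X))\<close>, so it has a representative \<open>\<G>\<close> containing \<open>f(X)\<close>; then the sets \<open>A\<close> with
  \<open>f(A) \<in> \<G>\<close> form a coarse ultrafilter on \<open>X\<close>, whose class is a preimage of \<open>[\<G>]\<close> and lies in
  the closure of \<open>S\<close>.\<close>

section \<open>Images of coarsely disjoint sets\<close>

lemma coarse_map_in_mspace: "coarse_map X Y f \<Longrightarrow> a \<in> mspace X \<Longrightarrow> f a \<in> mspace Y"
  by (auto simp: coarse_map_def)

lemma coarsely_disjoint_image:
  assumes f: "coarse_map X Y f" and inj: "coarsely_injective X Y f"
    and disj: "coarsely_disjoint X A B" and A: "A \<subseteq> mspace X" and B: "B \<subseteq> mspace X"
  shows "coarsely_disjoint Y (f ` A) (f ` B)"
  unfolding coarsely_disjoint_iff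
proof
  fix R
  note fY = coarse_map_in_mspace[OF f]
  define F where "F = {(u, v). u \<in> mspace Y \<and> v \<in> mspace Y \<and> mdist Y u v \<le> 2 * R}"
  have "entourage Y F" by (auto simp: F_def entourage_iff)
  then have "entourage X (map_prod f f -` F \<inter> mspace X \<times> mspace X)"
    using inj by (simp add: coarsely_injective_def)
  then obtain S where S: "mdist X u v \<le> S"
      if "(f u, f v) \<in> F" "u \<in> mspace X" "v \<in> mspace X" for u v
    unfolding entourage_iff by fastforce
  \<comment> \<open>\<open>S\<close> may be negative; the maximum with 0 ensures that a point of
    \<open>A\<close> lies in its own neighbourhood of \<open>A\<close>.\<close>
  define K where "K = nbhd X (max S 0) A \<inter> nbhd X (max S 0) B"
  have "coarsely_bounded X K" using disj by (simp add: coarsely_disjoint_iff K_def)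
  then have "entourage X (K \<times> K)" by (simp add: coarsely_bounded_def)
  then have "entourage Y (map_prod f f ` (K \<times> K))" by (rule coarse_map_entourage[OF f])
  then obtain T where T: "mdist Y (f u) (f v) \<le> T" if "u \<in> K" "v \<in> K" for u v
    unfolding entourage_iff by fastforce
  have near: "\<exists>a\<in>K. a \<in> mspace X \<and> mdist Y y (f a) \<le> R"
    if y: "y \<in> nbhd Y R (f ` A) \<inter> nbhd Y R (f ` B)" for y
  proof -
    from y obtain a b where ab: "y \<in> mspace Y" "a \<in> A" "mdist Y y (f a) \<le> R"
        "b \<in> B" "mdist Y y (f b) \<le> R"
      by (auto simp: nbhd_def)
    then have X: "a \<in> mspace X" "b \<in> mspace X" using A B by auto
    have "mdist Y (f a) (f b) \<le> mdist Y (f a) y + mdist Y y (f b)"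
      using ab X fY by (intro mdist_triangle) auto
    then have "mdist Y (f a) (f b) \<le> 2 * R"
      using ab mdist_commute[of Y y "f a"] by linarith
    then have "mdist X a b \<le> S" using X fY by (intro S) (simp_all add: F_def)
    then have "mdist X a b \<le> max S 0" by simp
    moreover have "mdist X a a = 0" using X by simp
    then have "mdist X a a \<le> max S 0" by simp
    ultimately have "a \<in> K" unfolding K_def nbhd_def using ab(2,4) X by blast
    then show ?thesis using X ab by blast
  qed
  show "coarsely_bounded Y (nbhd Y R (f ` A) \<inter> nbhd Y R (f ` B))"
    unfolding coarsely_bounded_iff
  proof (intro conjI exI ballI)
    show "nbhd Y R (f ` A) \<inter> nbhd Y R (f ` B) \<subseteq> mspace Y" by (auto simp: nbhd_def)
    fix y z
    assume y: "y \<in> nbhd Y R (f ` A) \<inter> nbhd Y R (f ` B)"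
      and z: "z \<in> nbhd Y R (f ` A) \<inter> nbhd Y R (f ` B)"
    obtain a b where a: "a \<in> K" "a \<in> mspace X" "mdist Y y (f a) \<le> R"
      and b: "b \<in> K" "b \<in> mspace X" "mdist Y z (f b) \<le> R"
      using near[OF y] near[OF z] by blast
    have yz: "y \<in> mspace Y" "z \<in> mspace Y" using y z by (auto simp: nbhd_def)
    have "mdist Y (f a) (f b) \<le> T" by (rule T[OF a(1) b(1)])
    moreover have "mdist Y y z \<le> mdist Y y (f a) + mdist Y (f a) z"
      using a yz fY by (intro mdist_triangle) auto
    moreover have "mdist Y (f a) z \<le> mdist Y (f a) (f b) + mdist Y (f b) z"
      using a b yz fY by (intro mdist_triangle) auto
    ultimately show "mdist Y y z \<le> R + T + R"
      using a b mdist_commute[of Y "f b" z] by linarith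
  qed
qed

section \<open>Representatives of corona points\<close>

text \<open>This is the largest coarse ultrafilter alike to \<open>\<F>\<close>: every ultrafilter
  alike to \<open>\<F>\<close> is contained in it. Both nontrivial axioms come from separating
  disjoint sets by a cover of the space, of which \<open>\<F>\<close> must contain one
  piece.\<close>

lemma coarse_ultrafilter_close_sets:
  assumes ult: "coarse_ultrafilter X \<F>"
  defines "\<G> \<equiv> {A. A \<subseteq> mspace X \<and> (\<forall>B\<in>\<F>. coarsely_close X A B)}"
  shows "coarse_ultrafilter X \<G>"
proof -
  have sub: "B \<subseteq> mspace X" if "B \<in> \<F>" for B
    using ult that by (auto simp: coarse_ultrafilter_def)
  \<comment> \<open>A set outside \<open>\<G>\<close> is avoided by some \<open>C\<close> that every
    cover argument forces into \<open>\<F>\<close>, as its complement is not in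
    \<open>\<F>\<close>.\<close>
  have sep: "\<exists>C. C \<subseteq> mspace X \<and> coarsely_disjoint X C A \<and> mspace X - C \<notin> \<F>"
    if A: "A \<subseteq> mspace X" "A \<notin> \<G>" for A
  proof -
    obtain B where B: "B \<in> \<F>" "coarsely_disjoint X A B" using A by (auto simp: \<G>_def)
    obtain C D where CD: "C \<union> D = mspace X" "coarsely_disjoint X C A" "coarsely_disjoint X D B"
      by (rule coarsely_disjoint_separate[OF B(2) A(1) sub[OF B(1)]])
    have "coarsely_disjoint X (mspace X - C) B"
      by (rule coarsely_disjoint_mono[OF CD(3)]) (use CD(1) in auto)
    then have "mspace X - C \<notin> \<F>" using ult B(1) by (auto simp: coarse_ultrafilter_def)
    then show ?thesis using CD by blast
  qed
  show ?thesis
    unfolding coarse_ultrafilter_def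
  proof (intro conjI ballI allI impI notI)
    show "\<G> \<subseteq> Pow (mspace X)" "mspace X \<in> \<G>"
      using ult by (auto simp: \<G>_def coarse_ultrafilter_def)
  next
    fix A B assume A: "A \<in> \<G>" and B: "B \<in> \<G>" and AB: "coarsely_disjoint X A B"
    have sub': "A \<subseteq> mspace X" "B \<subseteq> mspace X" using A B by (auto simp: \<G>_def)
    obtain C D where
      CD: "C \<union> D = mspace X" "coarsely_disjoint X C A" "coarsely_disjoint X D B"
      by (rule coarsely_disjoint_separate[OF AB sub'])
    have "C \<in> \<F> \<or> D \<in> \<F>" using coarse_ultrafilter_cover[OF ult CD(1)] .
    then show False using A B CD(2,3) by (auto simp: \<G>_def coarsely_disjoint_commute)
  next
    fix A B assume A: "A \<subseteq> mspace X" and B: "B \<subseteq> mspace X" and AB: "A \<union> B \<in> \<G>"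
    show "A \<in> \<G> \<or> B \<in> \<G>"
    proof (rule ccontr)
      assume "\<not> ?thesis"
      then have nA: "A \<notin> \<G>" and nB: "B \<notin> \<G>" by auto
      obtain C D where
        C: "C \<subseteq> mspace X" "coarsely_disjoint X C A" "mspace X - C \<notin> \<F>" and
        D: "D \<subseteq> mspace X" "coarsely_disjoint X D B" "mspace X - D \<notin> \<F>"
        using sep[OF A nA] sep[OF B nB] by blast
      \<comment> \<open>\<open>\<F>\<close> need not be closed under intersections, but neither
        complement is in \<open>\<F>\<close>, so the remaining piece of the cover is.\<close>
      have "(C \<inter> D) \<union> ((mspace X - C) \<union> (mspace X - D)) = mspace X" using C(1) D(1) by blast
      then have "C \<inter> D \<in> \<F>"
        using coarse_ultrafilter_cover[OF ult] coarse_ultrafilter_Un[OF ult] C(3) D(3) by blast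
      moreover have "coarsely_disjoint X (C \<inter> D) (A \<union> B)"
        by (intro coarsely_disjoint_Un coarsely_disjoint_mono[OF C(2)]
            coarsely_disjoint_mono[OF D(2)]) auto
      ultimately show False
        using AB by (auto simp: \<G>_def coarsely_disjoint_commute)
    qed
  qed
qed

lemma asymptotically_alike_class:
  "coarse_ultrafilter X \<F> \<Longrightarrow>
    asymptotically_alike X `` {\<F>} \<in> corona X \<and> \<F> \<in> asymptotically_alike X `` {\<F>}"
  unfolding corona_def using equiv_class_self[OF equiv_asymptotically_alike] by (simp add: quotientI)

lemma corona_eq_class:
  assumes x: "x \<in> corona X" and F: "\<F> \<in> x"
  shows "x = asymptotically_alike X `` {\<F>}"
proof -
  obtain \<G> where G: "x = asymptotically_alike X `` {\<G>}"
    using x unfolding corona_def by (rule quotientE)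
  then have "(\<G>, \<F>) \<in> asymptotically_alike X" using F by simp
  then show ?thesis unfolding G by (rule equiv_class_eq[OF equiv_asymptotically_alike])
qed

lemma corona_eqI:
  assumes x: "x \<in> corona X" "\<F> \<in> x" and y: "y \<in> corona X" "\<G> \<in> y"
    and close: "\<And>A B. A \<in> \<F> \<Longrightarrow> B \<in> \<G> \<Longrightarrow> coarsely_close X A B"
  shows "x = y"
proof -
  have "(\<F>, \<G>) \<in> asymptotically_alike X"
    using corona_members[OF x] corona_members[OF y] close by (simp add: asymptotically_alike_def)
  then show ?thesis
    unfolding corona_eq_class[OF x] corona_eq_class[OF y]
    by (rule equiv_class_eq[OF equiv_asymptotically_alike])
qed

text \<open>Membership in a closure asks for some suitable representative; here any given one serves
  as a test, because the class also contains the largest representative.\<close>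

lemma corona_cl_iff:
  assumes x: "x \<in> corona X" "\<F> \<in> x" and A: "A \<subseteq> mspace X"
  shows "x \<in> corona_cl X A \<longleftrightarrow> (\<forall>B\<in>\<F>. coarsely_close X A B)"
proof
  assume "x \<in> corona_cl X A"
  then show "\<forall>B\<in>\<F>. coarsely_close X A B"
    using corona_close_members[of x X] x by (auto simp: corona_cl_def)
next
  assume close: "\<forall>B\<in>\<F>. coarsely_close X A B"
  define \<G> where "\<G> = {A. A \<subseteq> mspace X \<and> (\<forall>B\<in>\<F>. coarsely_close X A B)}"
  have \<G>: "coarse_ultrafilter X \<G>"
    unfolding \<G>_def by (rule coarse_ultrafilter_close_sets) (rule corona_members[OF x])
  have "asymptotically_alike X `` {\<G>} = x"
    by (rule corona_eqI[of _ X \<G> _ \<F>]) (use asymptotically_alike_class[OF \<G>] x in \<open>auto simp: \<G>_def\<close>)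
  then have "\<G> \<in> x" using asymptotically_alike_class[OF \<G>] by metis
  moreover have "A \<in> \<G>" using A close by (simp add: \<G>_def)
  ultimately show "x \<in> corona_cl X A" using x by (auto simp: corona_cl_def)
qed

section \<open>The induced map and the proximity\<close>

lemma corona_map_pushforward:
  assumes f: "coarse_map X Y f" and x: "x \<in> corona X" "\<F> \<in> x"
  shows "corona_map X Y f x \<in> corona Y" "pushforward X Y f \<F> \<in> corona_map X Y f x"
proof -
  have F: "coarse_ultrafilter X \<F>" using corona_members[OF x] .
  have "corona_map X Y f x = asymptotically_alike Y `` {pushforward X Y f \<F>}"
    using corona_eq_class[OF x] corona_map_class[OF f F] by simp
  then show "corona_map X Y f x \<in> corona Y" "pushforward X Y f \<F> \<in> corona_map X Y f x"
    using asymptotically_alike_class[OF coarse_ultrafilter_pushforward[OF f F]] by simp_all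
qed

lemma corona_map_in_corona:
  "coarse_map X Y f \<Longrightarrow> x \<in> corona X \<Longrightarrow> corona_map X Y f x \<in> corona Y"
  using corona_map_pushforward(1) corona_nonempty by blast

lemma corona_map_cl_image:
  assumes f: "coarse_map X Y f" and A: "A \<subseteq> mspace X" and x: "x \<in> corona_cl X A"
  shows "corona_map X Y f x \<in> corona_cl Y (f ` A)"
proof -
  have "A \<subseteq> f -` (f ` A) \<inter> mspace X" using A by auto
  then have "x \<in> corona_cl X (f -` (f ` A) \<inter> mspace X)"
    using x corona_cl_mono by (meson inf_le2 subsetD)
  then obtain \<F> where F: "x \<in> corona X" "\<F> \<in> x" "f -` (f ` A) \<inter> mspace X \<in> \<F>"
    by (auto simp: corona_cl_def)
  then have "f ` A \<in> pushforward X Y f \<F>"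
    using A coarse_map_in_mspace[OF f] by (auto simp: pushforward_def)
  then show ?thesis using corona_map_pushforward[OF f F(1,2)] by (auto simp: corona_cl_def)
qed

text \<open>The pushforward cannot contain \<open>C\<close>, so it contains \<open>D\<close>. The
  enlargement \<open>D\<close> of \<open>A\<close> is essential: \<open>A\<close> may be close to
  the range of \<open>f\<close> and yet have empty preimage.\<close>

lemma corona_cl_vimage:
  assumes f: "coarse_map X Y f" and x: "x \<in> corona X"
    and fx: "corona_map X Y f x \<in> corona_cl Y A" and A: "A \<subseteq> mspace Y"
    and CD: "C \<union> D = mspace Y" "coarsely_disjoint Y C A"
  shows "x \<in> corona_cl X (f -` D \<inter> mspace X)"
proof -
  obtain \<F> where F: "\<F> \<in> x" using x corona_nonempty by blast
  have "D \<in> pushforward X Y f \<F>"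
    by (rule corona_cl_members(2)[OF fx A CD corona_map_pushforward(2)[OF f x F]])
  then show ?thesis using x F by (auto simp: pushforward_def corona_cl_def)
qed

text \<open>Taking preimages requires enlarging both witnesses, hence two separations:
  \<open>D\<close> enlarges \<open>A\<close> away from \<open>B\<close>, then \<open>C'\<close>
  enlarges \<open>B\<close> away from \<open>D\<close>. The preimages of \<open>D\<close> and
  \<open>C'\<close> are the new witnesses.\<close>

lemma corona_apart_of_image:
  assumes f: "coarse_map X Y f" and P: "P \<subseteq> corona X" and Q: "Q \<subseteq> corona X"
    and apart: "corona_apart Y (corona_map X Y f ` P) (corona_map X Y f ` Q)"
  shows "corona_apart X P Q"
proof -
  obtain A B where AB: "A \<subseteq> mspace Y" "B \<subseteq> mspace Y" "coarsely_disjoint Y A B"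
      "corona_map X Y f ` P \<subseteq> corona_cl Y A" "corona_map X Y f ` Q \<subseteq> corona_cl Y B"
    using apart by (auto simp: corona_apart_def)
  obtain C D where CD: "C \<union> D = mspace Y" "coarsely_disjoint Y C A" "coarsely_disjoint Y D B"
    by (rule coarsely_disjoint_separate[OF AB(3,1,2)])
  have D: "D \<subseteq> mspace Y" using CD(1) by blast
  obtain C' D' where CD': "C' \<union> D' = mspace Y" "coarsely_disjoint Y C' D" "coarsely_disjoint Y D' B"
    by (rule coarsely_disjoint_separate[OF CD(3) D AB(2)])
  have "P \<subseteq> corona_cl X (f -` D \<inter> mspace X)"
    using corona_cl_vimage[OF f _ _ AB(1) CD(1,2)] P AB(4) by blast
  moreover have "Q \<subseteq> corona_cl X (f -` C' \<inter> mspace X)"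
    using corona_cl_vimage[OF f _ _ AB(2) _ CD'(3), of _ C'] CD'(1) Q AB(5) by blast
  moreover have "coarsely_disjoint X (f -` D \<inter> mspace X) (f -` C' \<inter> mspace X)"
    using coarsely_disjoint_vimage[OF f] CD'(2) coarsely_disjoint_commute by blast
  ultimately show ?thesis unfolding corona_apart_def by blast
qed

text \<open>The images of the two witnesses are again witnesses, since coarse injectivity keeps them
  coarsely disjoint.\<close>

lemma corona_apart_image:
  assumes f: "coarse_map X Y f" and inj: "coarsely_injective X Y f"
    and apart: "corona_apart X P Q"
  shows "corona_apart Y (corona_map X Y f ` P) (corona_map X Y f ` Q)"
proof -
  obtain A B where AB: "A \<subseteq> mspace X" "B \<subseteq> mspace X" "coarsely_disjoint X A B"
      "P \<subseteq> corona_cl X A" "Q \<subseteq> corona_cl X B"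
    using apart by (auto simp: corona_apart_def)
  have "f ` A \<subseteq> mspace Y" "f ` B \<subseteq> mspace Y"
    using AB coarse_map_in_mspace[OF f] by auto
  moreover have "coarsely_disjoint Y (f ` A) (f ` B)"
    by (rule coarsely_disjoint_image[OF f inj AB(3,1,2)])
  moreover have "corona_map X Y f ` P \<subseteq> corona_cl Y (f ` A)"
      "corona_map X Y f ` Q \<subseteq> corona_cl Y (f ` B)"
    using corona_map_cl_image[OF f AB(1)] corona_map_cl_image[OF f AB(2)] AB(4,5) by blast+
  ultimately show ?thesis unfolding corona_apart_def by (intro exI conjI)
qed

section \<open>Separated points, closed sets and the range\<close>

lemma corona_apart_points:
  assumes x: "x \<in> corona X" and y: "y \<in> corona X" and "x \<noteq> y"
  shows "corona_apart X {x} {y}"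
proof -
  obtain \<F> \<G> where F: "\<F> \<in> x" and G: "\<G> \<in> y" using x y corona_nonempty by blast
  obtain A B where "A \<in> \<F>" "B \<in> \<G>" "coarsely_disjoint X A B"
    using corona_eqI[OF x F y G] assms(3) by blast
  moreover have "A \<subseteq> mspace X" "B \<subseteq> mspace X"
    using calculation corona_members[OF x F] corona_members[OF y G]
    by (auto simp: coarse_ultrafilter_def)
  ultimately show ?thesis
    using x y F G unfolding corona_apart_def corona_cl_def by blast
qed

text \<open>This says that \<open>corona_cl X A\<close> is closed: any representative of a point
  outside it has a member coarsely disjoint from \<open>A\<close>.\<close>

lemma corona_apart_point_cl:
  assumes x: "x \<in> corona X" and A: "A \<subseteq> mspace X" and "x \<notin> corona_cl X A"
  shows "corona_apart X {x} (corona_cl X A)"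
proof -
  obtain \<F> where F: "\<F> \<in> x" using x corona_nonempty by blast
  obtain B where B: "B \<in> \<F>" "coarsely_disjoint X A B"
    using corona_cl_iff[OF x F A] assms(3) by blast
  moreover have "B \<subseteq> mspace X"
    using B corona_members[OF x F] by (auto simp: coarse_ultrafilter_def)
  moreover have "{x} \<subseteq> corona_cl X B" using x F B by (auto simp: corona_cl_def)
  ultimately show ?thesis
    using A coarsely_disjoint_commute[of X A B] unfolding corona_apart_def by blast
qed

lemma corona_subset_cl_mspace: "corona X \<subseteq> corona_cl X (mspace X)"
proof
  fix x assume x: "x \<in> corona X"
  then obtain \<F> where F: "\<F> \<in> x" using corona_nonempty by blast
  show "x \<in> corona_cl X (mspace X)"
    using x F corona_members[OF x F] by (auto simp: corona_cl_def coarse_ultrafilter_def)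
qed

lemma corona_cl_image_subset_range:
  assumes f: "coarse_map X Y f" and inj: "coarsely_injective X Y f"
  shows "corona_cl Y (f ` mspace X) \<subseteq> corona_map X Y f ` corona X"
proof
  fix y assume "y \<in> corona_cl Y (f ` mspace X)"
  then obtain \<G> where y: "y \<in> corona Y" and G: "\<G> \<in> y" "f ` mspace X \<in> \<G>"
    by (auto simp: corona_cl_def)
  have ult: "coarse_ultrafilter Y \<G>" using corona_members[OF y G(1)] .
  define \<F> where "\<F> = {A. A \<subseteq> mspace X \<and> f ` A \<in> \<G>}"
  have F: "coarse_ultrafilter X \<F>"
    unfolding coarse_ultrafilter_def
  proof (intro conjI ballI allI impI notI)
    show "\<F> \<subseteq> Pow (mspace X)" "mspace X \<in> \<F>" using G by (auto simp: \<F>_def)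
  next
    fix A B assume A: "A \<in> \<F>" and B: "B \<in> \<F>" and "coarsely_disjoint X A B"
    then have "coarsely_disjoint Y (f ` A) (f ` B)"
      using coarsely_disjoint_image[OF f inj] by (simp add: \<F>_def)
    then show False using A B ult by (auto simp: \<F>_def coarse_ultrafilter_def)
  next
    fix A B assume "A \<subseteq> mspace X" "B \<subseteq> mspace X" "A \<union> B \<in> \<F>"
    then show "A \<in> \<F> \<or> B \<in> \<F>"
      using coarse_ultrafilter_Un[OF ult, of "f ` A" "f ` B"] by (simp add: \<F>_def image_Un)
  qed
  define x where "x = asymptotically_alike X `` {\<F>}"
  have x: "x \<in> corona X" "\<F> \<in> x" using asymptotically_alike_class[OF F] by (auto simp: x_def)
  have "corona_map X Y f x = y"
  \<comment> \<open>It suffices that the pushforward is alike to \<open>\<G>\<close>: each of its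
    members \<open>A\<close> contains \<open>f\<close> (f -\<open>A \<inter> mspace X)\<close>,
    which lies in \<open>\<G>\<close>.\<close>
  proof (rule corona_eqI[OF corona_map_pushforward[OF f x] y G(1)])
    fix A B assume A: "A \<in> pushforward X Y f \<F>" and B: "B \<in> \<G>"
    have "f ` (f -` A \<inter> mspace X) \<in> \<G>" using A by (simp add: pushforward_def \<F>_def)
    then have "coarsely_close Y (f ` (f -` A \<inter> mspace X)) B"
      using B ult by (simp add: coarse_ultrafilter_def)
    then show "coarsely_close Y A B"
      using coarsely_disjoint_mono[of Y A B "f ` (f -` A \<inter> mspace X)" B] by blast
  qed
  then show "y \<in> corona_map X Y f ` corona X" using x by blast
qed

section \<open>Injectivity, continuity and closedness\<close>

lemma corona_map_inj_on:
  assumes f: "coarse_map X Y f" and inj: "coarsely_injective X Y f"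
  shows "inj_on (corona_map X Y f) (corona X)"
proof (rule inj_onI, rule ccontr)
  fix x y assume xy: "x \<in> corona X" "y \<in> corona X" "corona_map X Y f x = corona_map X Y f y" "x \<noteq> y"
  then have "corona_apart Y {corona_map X Y f x} {corona_map X Y f y}"
    using corona_apart_image[OF f inj corona_apart_points[OF xy(1,2,4)]] by simp
  then show False using corona_apart_point_not_in xy(3) by fastforce
qed

lemma continuous_map_corona_map:
  assumes f: "coarse_map X Y f"
  shows "continuous_map (corona_topology X) (corona_topology Y) (corona_map X Y f)"
  unfolding continuous_map_eq_image_closure_subset_alt topspace_corona_topology
proof (intro allI impI Pi_I)
  fix S x
  assume S: "S \<subseteq> corona X" and x: "x \<in> corona_topology X closure_of S"
  have x: "x \<in> corona X" "corona_close X {x} S"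
    using x by (simp_all add: closure_of_corona_topology[OF S])
  have "corona_map X Y f ` S \<subseteq> corona Y" using S corona_map_in_corona[OF f] by blast
  moreover have "corona_close Y {corona_map X Y f x} (corona_map X Y f ` S)"
    using corona_apart_of_image[OF f _ S, of "{x}"] x by auto
  ultimately show "corona_map X Y f x \<in> corona_topology Y closure_of corona_map X Y f ` S"
    using corona_map_in_corona[OF f x(1)] by (simp add: closure_of_corona_topology)
qed

lemma closed_map_corona_map:
  assumes f: "coarse_map X Y f" and inj: "coarsely_injective X Y f"
  shows "closed_map (corona_topology X) (corona_topology Y) (corona_map X Y f)"
  unfolding closed_map_closure_of_image topspace_corona_topology
proof (intro conjI allI impI Pi_I subsetI)
  show "corona_map X Y f x \<in> corona Y" if "x \<in> corona X" for x
    using corona_map_in_corona[OF f that] .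
next
  fix S y
  assume S: "S \<subseteq> corona X" and y: "y \<in> corona_topology Y closure_of corona_map X Y f ` S"
  have "corona_map X Y f ` S \<subseteq> corona Y" using S corona_map_in_corona[OF f] by blast
  then have y: "y \<in> corona Y" "corona_close Y {y} (corona_map X Y f ` S)"
    using y by (simp_all add: closure_of_corona_topology)
  have fX: "f ` mspace X \<subseteq> mspace Y" using coarse_map_in_mspace[OF f] by blast
  have "corona_map X Y f ` S \<subseteq> corona_cl Y (f ` mspace X)"
    using S corona_subset_cl_mspace[of X] corona_map_cl_image[OF f order_refl] by blast
  then have "y \<in> corona_cl Y (f ` mspace X)"
    using y corona_apart_point_cl[OF y(1) fX] corona_apart_mono by blast
  then obtain x where x: "x \<in> corona X" "y = corona_map X Y f x"
    using corona_cl_image_subset_range[OF f inj] by blast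
  \<comment> \<open>Were \<open>x\<close> apart from \<open>S\<close>, its image \<open>y\<close>
    would be apart from the image of \<open>S\<close>.\<close>
  have "corona_close X {x} S"
    using y(2) x(2) corona_apart_image[OF f inj, of "{x}" S] by auto
  then show "y \<in> corona_map X Y f ` (corona_topology X closure_of S)"
    using x by (simp add: closure_of_corona_topology[OF S])
qed

theorem lemma39:
  fixes X :: "'a metric" and Y :: "'b metric" and f :: "'a \<Rightarrow> 'b"
  assumes "coarse_map X Y f" and "coarsely_injective X Y f"
  shows "embedding_map (corona_topology X) (corona_topology Y) (corona_map X Y f) \<and>
         closed_map (corona_topology X) (corona_topology Y) (corona_map X Y f)"
proof (intro conjI injective_closed_imp_embedding_map)
  show "continuous_map (corona_topology X) (corona_topology Y) (corona_map X Y f)"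
    by (rule continuous_map_corona_map[OF assms(1)])
  show "closed_map (corona_topology X) (corona_topology Y) (corona_map X Y f)"
    by (rule closed_map_corona_map[OF assms])
  then show "closed_map (corona_topology X) (corona_topology Y) (corona_map X Y f)" .
  show "inj_on (corona_map X Y f) (topspace (corona_topology X))"
    using corona_map_inj_on[OF assms] by simp
qed

end
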